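(* (Soundness of the tableau system $\mathsf{TC}_{\mathsf{SCI}}$.) For every $\mathsf{SCI}$-formula $\varphi$: if $\varphi$ is satisfiable, then $\varphi$ is tableau-satisfiable, i.e., there exists an open and fully expanded $\mathsf{TC}_{\mathsf{SCI}}$-tableau whose root is $w^+:\varphi$ for some $w^+\in\mathsf{L}^+$.
   Context: Logic SCI. Fix a countably infinite set $\mathsf{AF}$ of atomic formulas. The set $\mathsf{FOR}$ of SCI-formulas is given by $\varphi ::= p \mid \neg\varphi \mid \varphi\to\varphi \mid \varphi\equiv\varphi$ with $p\in\mathsf{AF}$. An SCI-model is a structure $\mathcal{M}=\langle U,D,\tilde\neg,\tilde\to,\tilde\equiv\rangle$ where $U\neq\emptyset$, $D\subseteq U$, $\tilde\neg:U\to U$, $\tilde\to,\tilde\equiv:U\times U\to U$, such that for all $a,b\in U$: $\tilde\neg a\in D$ iff $a\notin D$; $a\tilde\to b\in D$ iff $a\notin D$ or $b\in D$; $a\tilde\equiv b\in D$ iff $a=b$. A valuation in $\mathcal{M}$ is a map $V:\mathsf{FOR}\to U$ with $V(\neg\varphi)=\tilde\neg V(\varphi)$, $V(\varphi\to\psi)=V(\varphi)\tilde\to V(\psi)$, $V(\varphi\equiv\psi)=V(\varphi)\tilde\equiv V(\psi)$. A formula $\varphi$ is satisfied by $\mathcal{M},V$ if $V(\varphi)\in D$; satisfiable if it is satisfied in some SCI-model by some valuation; valid if satisfied in every SCI-model by every valuation. Tableau system $\mathsf{TC}_{\mathsf{SCI}}$. Let $\mathsf{L}^+,\mathsf{L}^-$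 be disjoint countably infinite sets of labels, $\mathsf{L}=\mathsf{L}^+\cup\mathsf{L}^-$; a label written $w^+$ lies in $\mathsf{L}^+$, $w^-$ in $\mathsf{L}^-$, an unsuperscripted label is arbitrary. A labelled formula is $w:\varphi$ with $w\in\mathsf{L},\varphi\in\mathsf{FOR}$. Equality statements $w=v$ and inequality statements $w\neq v$ ($w,v\in\mathsf{L}$) may also occur. A tableau is a tree whose nodes carry labelled formulas, (in)equality statements or $\bot$; a branch is a root-to-leaf path, identified with the set of items on it. Rules (premises / alternative conclusion sets separated by $\mid$): Decomposition rules (all labels in the conclusions are fresh, i.e. do not yet occur on the branch): $(\neg^+)$ $w^+:\neg\varphi$ / $v^-:\varphi$; $(\neg^-)$ $w^-:\neg\varphi$ / $v^+:\varphi$; $(\to^+)$ $w^+:\varphi\to\psi$ / $\{v^-:\varphi,u^-:\psi\}\mid\{v^-:\varphi,u^+:\psi\}\mid\{v^+:\varphi,u^+:\psi\}$; $(\to^-)$ $w^-:\varphi\to\psi$ / $\{v^+:\varphi,u^-:\psi\}$; $(\equiv^+)$ $w^+:\varphi\equiv\psi$ / $\{v^+:\varphi,u^+:\psi,v^+=u^+\}\mid\{v^-:\varphi,u^-:\psi,v^-=u^-\}$; $(\equiv^-)$ $w^-:\varphi\equiv\psi$ / $\{v^+:\varphi,u^+:\psi,v^+\neq u^+\}\mid\{v^+:\varphi,u^-:\psi\}\mid\{v^-:\varphi,u^+:\psi\}\mid\{v^-:\varphi,u^-:\psi,v^-\neq u^-\}$. Equality rules, where $\varphi\approx\psi$ abbreviates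 the three premises $w:\varphi$, $v:\psi$, $w=v$ for some labels $w,v$: $(\equiv^\neg)$ $\varphi\approx\psi$, $u:\neg\varphi$, $y:\neg\psi$ / $u=y$; $(\equiv^\to)$ $\varphi\approx\psi$, $\chi\approx\theta$, $x:\varphi\to\chi$, $z:\psi\to\theta$ / $x=z$; $(\equiv^\equiv)$ $\varphi\approx\psi$, $\chi\approx\theta$, $x:\varphi\equiv\chi$, $z:\psi\equiv\theta$ / $x=z$; $(\mathsf F)$ $w:\varphi$, $v:\varphi$ / $w=v$; $(\mathsf{sym})$ $w=v$ / $v=w$; $(\mathsf{tran})$ $w=v$, $v=u$ / $w=u$. Closure rules: $(\bot_1)$ $w=v$, $w\neq v$ / $\bot$; $(\bot_2)$ $w^+=v^-$ / $\bot$. A branch is extended by applying a rule to items on it, each alternative conclusion set giving a new branch. A decomposition rule may be applied to $w:\varphi$ on a branch only if it has not been applied to $w:\varphi$ on that branch before; an equality rule may be applied to premises on a branch only if its conclusion is not already on the branch. Closure rules are applied eagerly. A branch is closed if a closure rule has been applied on it, open otherwise; fully expanded if it is closed or no rule is applicable on it. A tableau is closed if all its branches are closed, open otherwise, and fully expanded if all its branches are. A formula $\varphi$ is tableau-satisfiable if there is an open, fully expanded tableau with $w^+:\varphi$ at its root. *)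

theory Defs
  imports Main "HOL-Library.Countable" "HOL-Library.Infinite_Typeclass"
begin

datatype 'p form =
    Atom 'p
  | Neg "'p form"
  | Imp "'p form" "'p form"
  | Ident "'p form" "'p form"

record 'u sci_struct =
  univ :: "'u set"
  desig :: "'u set"
  mneg :: "'u \<Rightarrow> 'u"
  mimp :: "'u \<Rightarrow> 'u \<Rightarrow> 'u"
  mident :: "'u \<Rightarrow> 'u \<Rightarrow> 'u"

definition sci_model :: "'u sci_struct \<Rightarrow> bool" where
  "sci_model M \<longleftrightarrow>
     univ M \<noteq> {} \<and> desig M \<subseteq> univ M \<and>
     (\<forall>a\<in>univ M. mneg M a \<in> univ M) \<and>
     (\<forall>a\<in>univ M. \<forall>b\<in>univ M. mimp M a b \<in> univ M) \<and>
     (\<forall>a\<in>univ M. \<forall>b\<in>univ M. mident M a b \<in> univ M) \<and>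
     (\<forall>a\<in>univ M. mneg M a \<in> desig M \<longleftrightarrow> a \<notin> desig M) \<and>
     (\<forall>a\<in>univ M. \<forall>b\<in>univ M. mimp M a b \<in> desig M \<longleftrightarrow> a \<notin> desig M \<or> b \<in> desig M) \<and>
     (\<forall>a\<in>univ M. \<forall>b\<in>univ M. mident M a b \<in> desig M \<longleftrightarrow> a = b)"

definition valuation :: "'u sci_struct \<Rightarrow> ('p form \<Rightarrow> 'u) \<Rightarrow> bool" where
  "valuation M V \<longleftrightarrow>
     (\<forall>\<phi>. V \<phi> \<in> univ M) \<and>
     (\<forall>\<phi>. V (Neg \<phi>) = mneg M (V \<phi>)) \<and>
     (\<forall>\<phi> \<psi>. V (Imp \<phi> \<psi>) = mimp M (V \<phi>) (V \<psi>)) \<and>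
     (\<forall>\<phi> \<psi>. V (Ident \<phi> \<psi>) = mident M (V \<phi>) (V \<psi>))"

definition satisfied :: "'u sci_struct \<Rightarrow> ('p form \<Rightarrow> 'u) \<Rightarrow> 'p form \<Rightarrow> bool" where
  "satisfied M V \<phi> \<longleftrightarrow> V \<phi> \<in> desig M"

text \<open>
  HOL cannot quantify over types inside a formula, so the type in which the universes of the
  models live is a parameter. In a premise, a free type variable \<open>'u\<close> then ranges over all types,
  so that \<open>satisfiable TYPE('u) \<phi>\<close> as a hypothesis covers models over arbitrary universes.
\<close>

definition satisfiable :: "'u itself \<Rightarrow> 'p form \<Rightarrow> bool" where
  "satisfiable TYPE('u) \<phi> \<longleftrightarrow>
     (\<exists>(M :: 'u sci_struct) V. sci_model M \<and> valuation M V \<and> satisfied M V \<phi>)"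

text \<open>
  Two tagged copies of one type serve as the disjoint sets of positive and negative labels. If
  \<open>'l\<close> is countably infinite, so are both.
\<close>

datatype 'l label = PosL 'l | NegL 'l

datatype ('p, 'l) item =
    Lab "'l label" "'p form"
  | Eq "'l label" "'l label"
  | Neq "'l label" "'l label"
  | Bot

type_synonym ('p, 'l) labelled = "'l label \<times> 'p form"

fun item_labels :: "('p, 'l) item \<Rightarrow> 'l label set" where
  "item_labels (Lab w \<phi>) = {w}"
| "item_labels (Eq w v) = {w, v}"
| "item_labels (Neq w v) = {w, v}"
| "item_labels Bot = {}"

definition labels_of :: "('p, 'l) item set \<Rightarrow> 'l label set" where
  "labels_of B = (\<Union>i\<in>B. item_labels i)"

text \<open>
  \<open>decomp (w, \<phi>) alts\<close>: the list \<open>alts\<close> consists of the alternative conclusion sets of an instance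
  of the decomposition rule for \<open>w : \<phi>\<close>. Primed variables underlie the positive new labels where
  a rule introduces two labels of each sign. Distinct label variables of the same sign stand for
  distinct labels; that they do not occur on the branch is required where the rule is applied.
\<close>

inductive decomp :: "('p, 'l) labelled \<Rightarrow> ('p, 'l) item set list \<Rightarrow> bool" where
  neg_pos:
    "decomp (PosL w, Neg \<phi>) [{Lab (NegL v) \<phi>}]"
| neg_neg:
    "decomp (NegL w, Neg \<phi>) [{Lab (PosL v) \<phi>}]"
| imp_pos:
    "v \<noteq> u \<Longrightarrow> v' \<noteq> u' \<Longrightarrow>
     decomp (PosL w, Imp \<phi> \<psi>)
       [{Lab (NegL v) \<phi>, Lab (NegL u) \<psi>},
        {Lab (NegL v) \<phi>, Lab (PosL u') \<psi>},
        {Lab (PosL v') \<phi>, Lab (PosL u') \<psi>}]"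
| imp_neg:
    "decomp (NegL w, Imp \<phi> \<psi>) [{Lab (PosL v) \<phi>, Lab (NegL u) \<psi>}]"
| ident_pos:
    "v \<noteq> u \<Longrightarrow> v' \<noteq> u' \<Longrightarrow>
     decomp (PosL w, Ident \<phi> \<psi>)
       [{Lab (PosL v') \<phi>, Lab (PosL u') \<psi>, Eq (PosL v') (PosL u')},
        {Lab (NegL v) \<phi>, Lab (NegL u) \<psi>, Eq (NegL v) (NegL u)}]"
| ident_neg:
    "v \<noteq> u \<Longrightarrow> v' \<noteq> u' \<Longrightarrow>
     decomp (NegL w, Ident \<phi> \<psi>)
       [{Lab (PosL v') \<phi>, Lab (PosL u') \<psi>, Neq (PosL v') (PosL u')},
        {Lab (PosL v') \<phi>, Lab (NegL u) \<psi>},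
        {Lab (NegL v) \<phi>, Lab (PosL u') \<psi>},
        {Lab (NegL v) \<phi>, Lab (NegL u) \<psi>, Neq (NegL v) (NegL u)}]"

definition approx :: "('p, 'l) item set \<Rightarrow> 'p form \<Rightarrow> 'p form \<Rightarrow> bool" where
  "approx B \<phi> \<psi> \<longleftrightarrow> (\<exists>w v. Lab w \<phi> \<in> B \<and> Lab v \<psi> \<in> B \<and> Eq w v \<in> B)"

inductive equality_rule :: "('p, 'l) item set \<Rightarrow> ('p, 'l) item \<Rightarrow> bool" for B where
  eq_neg:
    "approx B \<phi> \<psi> \<Longrightarrow> Lab u (Neg \<phi>) \<in> B \<Longrightarrow> Lab y (Neg \<psi>) \<in> B \<Longrightarrow> equality_rule B (Eq u y)"
| eq_imp:
    "approx B \<phi> \<psi> \<Longrightarrow> approx B \<chi> \<theta> \<Longrightarrow> Lab x (Imp \<phi> \<chi>) \<in> B \<Longrightarrow> Lab z (Imp \<psi> \<theta>) \<in> B \<Longrightarrow>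
     equality_rule B (Eq x z)"
| eq_ident:
    "approx B \<phi> \<psi> \<Longrightarrow> approx B \<chi> \<theta> \<Longrightarrow> Lab x (Ident \<phi> \<chi>) \<in> B \<Longrightarrow> Lab z (Ident \<psi> \<theta>) \<in> B \<Longrightarrow>
     equality_rule B (Eq x z)"
| eq_fun:
    "Lab w \<phi> \<in> B \<Longrightarrow> Lab v \<phi> \<in> B \<Longrightarrow> equality_rule B (Eq w v)"
| eq_sym:
    "Eq w v \<in> B \<Longrightarrow> equality_rule B (Eq v w)"
| eq_tran:
    "Eq w v \<in> B \<Longrightarrow> Eq v u \<in> B \<Longrightarrow> equality_rule B (Eq w u)"

inductive closure_rule :: "('p, 'l) item set \<Rightarrow> bool" for B where
  bot1: "Eq w v \<in> B \<Longrightarrow> Neq w v \<in> B \<Longrightarrow> closure_rule B"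
| bot2: "Eq (PosL w) (NegL v) \<in> B \<Longrightarrow> closure_rule B"

datatype 'n tree = Node (root: 'n) (children: "'n tree list")

fun branches :: "'n tree \<Rightarrow> 'n list set" where
  "branches (Node n ts) = (if ts = [] then {[n]} else (\<Union>t\<in>set ts. (#) n ` branches t))"

text \<open>
  A node carries the set of items that the rule application creating it adds to the branch,
  together with the labelled formula that was decomposed, if that rule is a decomposition rule.
  The second component makes it possible to read off a branch which decompositions have been
  performed on it. Branches and their initial segments are lists of nodes, the root first.
\<close>

type_synonym ('p, 'l) node = "('p, 'l) item set \<times> ('p, 'l) labelled option"

definition items :: "('p, 'l) node list \<Rightarrow> ('p, 'l) item set" where
  "items b = (\<Union>n\<in>set b. fst n)"

definition decomposed :: "('p, 'l) node list \<Rightarrow> ('p, 'l) labelled set" where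
  "decomposed b = {x. Some x \<in> snd ` set b}"

definition closed_branch :: "('p, 'l) node list \<Rightarrow> bool" where
  "closed_branch b \<longleftrightarrow> Bot \<in> items b"

text \<open>
  \<open>extends b ns\<close>: some rule may be applied on the branch \<open>b\<close> such that \<open>ns\<close> are the new nodes
  appended to \<open>b\<close>, one for each alternative conclusion set. No rule is applied on a closed branch.
  Eager application of the closure rules means that the other rules are blocked as long as a
  closure rule is applicable.
\<close>

inductive extends :: "('p, 'l) node list \<Rightarrow> ('p, 'l) node list \<Rightarrow> bool" where
  closure:
    "\<not> closed_branch b \<Longrightarrow> closure_rule (items b) \<Longrightarrow> extends b [({Bot}, None)]"
| equality:
    "\<not> closed_branch b \<Longrightarrow> \<not> closure_rule (items b) \<Longrightarrow>
     equality_rule (items b) e \<Longrightarrow> e \<notin> items b \<Longrightarrow> extends b [({e}, None)]"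
| decomposition:
    "\<not> closed_branch b \<Longrightarrow> \<not> closure_rule (items b) \<Longrightarrow>
     Lab w \<phi> \<in> items b \<Longrightarrow> (w, \<phi>) \<notin> decomposed b \<Longrightarrow> decomp (w, \<phi>) alts \<Longrightarrow>
     (\<forall>X\<in>set alts. labels_of X \<inter> labels_of (items b) = {}) \<Longrightarrow>
     extends b (map (\<lambda>X. (X, Some (w, \<phi>))) alts)"

text \<open>
  \<open>generated p t\<close>: every inner node of \<open>t\<close> has as its children the outcome of a rule application
  on the branch leading to that node, where \<open>p\<close> lists the nodes strictly above the root of \<open>t\<close>.
  Tableaux are finite trees, i.e. arise from finitely many rule applications.
\<close>

inductive generated :: "('p, 'l) node list \<Rightarrow> ('p, 'l) node tree \<Rightarrow> bool" where
  leaf: "generated p (Node n [])"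
| extend:
    "extends (p @ [n]) (map root ts) \<Longrightarrow> (\<forall>t\<in>set ts. generated (p @ [n]) t) \<Longrightarrow>
     generated p (Node n ts)"

definition tableau :: "('p, 'l) labelled \<Rightarrow> ('p, 'l) node tree \<Rightarrow> bool" where
  "tableau x T \<longleftrightarrow> root T = ({Lab (fst x) (snd x)}, None) \<and> generated [] T"

definition closed_tableau :: "('p, 'l) node tree \<Rightarrow> bool" where
  "closed_tableau T \<longleftrightarrow> (\<forall>b\<in>branches T. closed_branch b)"

definition open_tableau :: "('p, 'l) node tree \<Rightarrow> bool" where
  "open_tableau T \<longleftrightarrow> \<not> closed_tableau T"

definition fully_expanded_branch :: "('p, 'l) node list \<Rightarrow> bool" where
  "fully_expanded_branch b \<longleftrightarrow> closed_branch b \<or> \<not> (\<exists>ns. extends b ns)"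

definition fully_expanded :: "('p, 'l) node tree \<Rightarrow> bool" where
  "fully_expanded T \<longleftrightarrow> (\<forall>b\<in>branches T. fully_expanded_branch b)"

definition tableau_satisfiable :: "'l itself \<Rightarrow> 'p form \<Rightarrow> bool" where
  "tableau_satisfiable TYPE('l) \<phi> \<longleftrightarrow>
     (\<exists>(w :: 'l) (T :: ('p, 'l) node tree).
        tableau (PosL w, \<phi>) T \<and> open_tableau T \<and> fully_expanded T)"

end

theory Submission
  imports Defs
begin

text \<open>
  Every rule application decreases a lexicographic measure, so any branch can be expanded to a
  finite fully expanded tableau, whatever rules are chosen. A model of the root satisfies, after
  interpreting the fresh labels by values of the formulas they label, at least one alternative of
  every rule application; following these alternatives leads to a branch without \<open>Bot\<close>.
\<close>

section \<open>Termination\<close>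

definition pending :: "('p, 'l) node list \<Rightarrow> ('p, 'l) labelled set" where
  "pending b = {(w, \<phi>). Lab w \<phi> \<in> items b} - decomposed b"

text \<open>These pairs bound how many equality rules can still be applied before a decomposition
  brings in new labels.\<close>

definition missing_eqs :: "('p, 'l) node list \<Rightarrow> ('l label \<times> 'l label) set" where
  "missing_eqs b =
     {(w, v) \<in> labels_of (items b) \<times> labels_of (items b). Eq w v \<notin> items b}"

text \<open>Closure lowers the first component, decomposition the second, an equality rule the
  third. Missing equations come last because the fresh labels of a decomposition may add to
  them.\<close>

definition expansion_order :: "(('p, 'l) node list \<times> ('p, 'l) node list) set" where
  "expansion_order = measures
     [\<lambda>b. if closed_branch b then 0 else 1,
      \<lambda>b. \<Sum>x\<in>pending b. size (snd x),
      \<lambda>b. card (missing_eqs b)]"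

lemma wf_expansion_order: "wf expansion_order"
  by (simp add: expansion_order_def)

lemma items_append [simp]: "items (b @ c) = items b \<union> items c"
  by (auto simp: items_def)

lemma items_Cons [simp]: "items (n # b) = fst n \<union> items b"
  by (auto simp: items_def)

lemma items_Nil [simp]: "items [] = {}"
  by (simp add: items_def)

lemma decomposed_snoc: "decomposed (b @ [n]) = decomposed b \<union> {x. snd n = Some x}"
  by (auto simp: decomposed_def)

lemma finite_item_labels [simp]: "finite (item_labels i)"
  by (cases i) auto

lemma finite_labels_of: "finite B \<Longrightarrow> finite (labels_of B)"
  by (simp add: labels_of_def)

lemma finite_labelled:
  assumes "finite B"
  shows "finite {(w, \<phi>). Lab w \<phi> \<in> B}"
proof -
  have "(\<lambda>(w, \<phi>). Lab w \<phi>) ` {(w, \<phi>). Lab w \<phi> \<in> B} \<subseteq> B"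
    by auto
  then show ?thesis
    using assms by (rule inj_on_finite[rotated]) (auto simp: inj_on_def)
qed

lemma finite_pending: "finite (items b) \<Longrightarrow> finite (pending b)"
  unfolding pending_def by (intro finite_Diff finite_labelled)

lemma finite_missing_eqs: "finite (items b) \<Longrightarrow> finite (missing_eqs b)"
  unfolding missing_eqs_def
  by (rule finite_subset[of _ "labels_of (items b) \<times> labels_of (items b)"])
     (auto simp: finite_labels_of)

lemma decomp_nonempty: "decomp x alts \<Longrightarrow> alts \<noteq> []"
  by (auto elim: decomp.cases)

lemma decomp_finite: "decomp x alts \<Longrightarrow> X \<in> set alts \<Longrightarrow> finite X"
  by (auto elim!: decomp.cases)

lemma sum_insert2_le:
  fixes f :: "'a \<Rightarrow> nat"
  shows "sum f {x, y} \<le> f x + f y"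
  by (cases "x = y") auto

text \<open>An alternative labels each immediate subformula once, and the connective of
  \<open>\<phi>\<close> itself contributes one to its size.\<close>

lemma decomp_size:
  fixes w :: "'l label" and \<phi> :: "'p form"
  assumes "decomp (w, \<phi>) alts" "X \<in> set alts"
  shows "(\<Sum>x\<in>{(v, \<psi>). Lab v \<psi> \<in> X}. size (snd x)) < size \<phi>"
proof -
  have one: "{(v, \<psi>). v = a \<and> \<psi> = \<alpha>} = {(a, \<alpha>)}" for a :: "'l label" and \<alpha> :: "'p form"
    by auto
  have two: "(\<Sum>x\<in>{(v, \<psi>). v = a \<and> \<psi> = \<alpha> \<or> v = b \<and> \<psi> = \<beta>}. size (snd x))
      < Suc (size \<alpha> + size \<beta>)" for a b :: "'l label" and \<alpha> \<beta> :: "'p form"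
  proof -
    have "{(v, \<psi>). v = a \<and> \<psi> = \<alpha> \<or> v = b \<and> \<psi> = \<beta>} = {(a, \<alpha>), (b, \<beta>)}"
      by auto
    then show ?thesis
      using sum_insert2_le[of "\<lambda>x. size (snd x)" "(a, \<alpha>)" "(b, \<beta>)"] by simp
  qed
  from assms show ?thesis
    by (cases rule: decomp.cases) (simp_all add: one two, (elim disjE; simp add: one two)+)
qed

text \<open>Equality rules only relate labels already on the branch, so they cannot create new
  missing equations.\<close>

lemma equality_rule_Eq:
  assumes "equality_rule B e"
  obtains w v where "e = Eq w v" "w \<in> labels_of B" "v \<in> labels_of B"
proof -
  have Lab: "w \<in> labels_of B" if "Lab w \<phi> \<in> B" for w \<phi>
    using that by (force simp: labels_of_def)
  have Eq: "w \<in> labels_of B" "v \<in> labels_of B" if "Eq w v \<in> B" for w v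
    using that by (force simp: labels_of_def)+
  from assms have "\<exists>w v. e = Eq w v \<and> w \<in> labels_of B \<and> v \<in> labels_of B"
    by cases (blast intro: Lab Eq)+
  then show thesis
    using that by blast
qed

lemma extends_nonempty: "extends b ns \<Longrightarrow> ns \<noteq> []"
  by (auto elim!: extends.cases dest: decomp_nonempty)

lemma extends_finite: "extends b ns \<Longrightarrow> n \<in> set ns \<Longrightarrow> finite (fst n)"
  by (erule extends.cases) (auto intro: decomp_finite)

text \<open>Finiteness of the branch gives the sum and the cardinality their intended meaning: both
  are 0 on infinite sets.\<close>

lemma extends_decreases:
  assumes "extends b ns" "n \<in> set ns" "finite (items b)"
  shows "(b @ [n], b) \<in> expansion_order"
  using assms(1)
proof cases
  case closure
  then show ?thesis
    using assms(2) by (simp add: expansion_order_def closed_branch_def)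
next
  case (equality e)
  obtain w v where e: "e = Eq w v" "w \<in> labels_of (items b)" "v \<in> labels_of (items b)"
    using equality(4) by (rule equality_rule_Eq)
  have n: "n = ({Eq w v}, None)"
    using equality(1) assms(2) e(1) by simp
  have "closed_branch (b @ [n]) = closed_branch b"
    by (simp add: closed_branch_def n)
  moreover have "pending (b @ [n]) = pending b"
    by (auto simp: pending_def decomposed_snoc n)
  moreover have "card (missing_eqs (b @ [n])) < card (missing_eqs b)"
  proof (rule psubset_card_mono)
    have labels: "labels_of (items (b @ [n])) = labels_of (items b)"
      using e by (auto simp: labels_of_def n)
    have "(w, v) \<in> missing_eqs b" "(w, v) \<notin> missing_eqs (b @ [n])"
      using e equality(5) by (auto simp: missing_eqs_def n)
    moreover have "missing_eqs (b @ [n]) \<subseteq> missing_eqs b"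
      unfolding missing_eqs_def labels by auto
    ultimately show "missing_eqs (b @ [n]) \<subset> missing_eqs b"
      by blast
  qed (use assms(3) in \<open>rule finite_missing_eqs\<close>)
  ultimately show ?thesis
    by (simp add: expansion_order_def)
next
  case (decomposition w \<phi> alts)
  obtain X where X: "X \<in> set alts" and n: "n = (X, Some (w, \<phi>))"
    using assms(2) decomposition(1) by auto
  define new where "new = {(v, \<psi>). Lab v \<psi> \<in> X}"
  have fin: "finite (pending b)" "finite new"
    using assms(3) decomp_finite[OF decomposition(6) X]
    by (auto simp: new_def finite_pending finite_labelled)
  have mem: "(w, \<phi>) \<in> pending b"
    using decomposition(4,5) by (simp add: pending_def)
  \<comment> \<open>The node \<open>n\<close> records \<open>(w, \<phi>)\<close> as decomposed,
    which removes it; only labelled formulas of \<open>X\<close> can enter.\<close>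
  have "pending (b @ [n]) \<subseteq> (pending b - {(w, \<phi>)}) \<union> new"
    by (auto simp: pending_def decomposed_snoc n new_def)
  then have "(\<Sum>x\<in>pending (b @ [n]). size (snd x))
      \<le> (\<Sum>x\<in>(pending b - {(w, \<phi>)}) \<union> new. size (snd x))"
    using fin by (intro sum_mono2) auto
  also have "\<dots> \<le> (\<Sum>x\<in>pending b - {(w, \<phi>)}. size (snd x)) + (\<Sum>x\<in>new. size (snd x))"
    using fin by (simp add: sum_Un_nat)
  also have "\<dots> < (\<Sum>x\<in>pending b - {(w, \<phi>)}. size (snd x)) + size \<phi>"
    using decomp_size[OF decomposition(6) X] by (simp add: new_def)
  also have "\<dots> = (\<Sum>x\<in>pending b. size (snd x))"
    using sum.remove[OF fin(1) mem, of "\<lambda>x. size (snd x)"] by simp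
  finally show ?thesis
    using decomposition(2) by (simp add: expansion_order_def)
qed

section \<open>Existence of fully expanded tableaux\<close>

text \<open>Well-founded induction on the branch: stop if it is fully expanded, otherwise apply any
  rule and graft the trees obtained for the extended branches. The prefix \<open>p\<close> is kept
  because the applicability of rules depends on the whole branch.\<close>

lemma fully_expanded_tree_exists:
  assumes "finite (items (p @ [n]))"
  shows "\<exists>T. root T = n \<and> generated p T \<and> (\<forall>b\<in>branches T. fully_expanded_branch (p @ b))"
proof -
  have "\<exists>T. root T = n \<and> generated p T \<and> (\<forall>b\<in>branches T. fully_expanded_branch (p @ b))"
    if "c = p @ [n]" "finite (items c)" for c
    using wf_expansion_order that
  proof (induction c arbitrary: p n rule: wf_induct_rule)
    case (less c)
    show ?case
    proof (cases "fully_expanded_branch c")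
      case True
      then show ?thesis
        using less.prems by (intro exI[of _ "Node n []"]) (auto intro: generated.leaf)
    next
      case False
      then obtain ns where ns: "extends c ns"
        by (auto simp: fully_expanded_branch_def)
      have "\<exists>T. root T = m \<and> generated c T \<and> (\<forall>b\<in>branches T. fully_expanded_branch (c @ b))"
        if "m \<in> set ns" for m
        using less.IH[of "c @ [m]" c m] extends_decreases[OF ns that] less.prems(2)
          extends_finite[OF ns that]
        by simp
      then obtain F where F: "\<And>m. m \<in> set ns \<Longrightarrow> root (F m) = m \<and> generated c (F m) \<and>
          (\<forall>b\<in>branches (F m). fully_expanded_branch (c @ b))"
        by metis
      have "map root (map F ns) = ns"
        using F by (simp add: map_idI)
      then have "generated p (Node n (map F ns))"
        using ns F less.prems(1) by (intro generated.extend) auto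
      \<comment> \<open>Since \<open>ns\<close> is nonempty, every branch continues into some
        \<open>F m\<close>; \<open>branches\<close> would read an empty list of children as a
        leaf.\<close>
      moreover have "\<forall>b\<in>branches (Node n (map F ns)). fully_expanded_branch (p @ b)"
        using F extends_nonempty[OF ns] less.prems(1) by auto
      ultimately show ?thesis
        by (intro exI[of _ "Node n (map F ns)"]) simp
    qed
  qed
  with assms show ?thesis
    by blast
qed

section \<open>Satisfied branches\<close>

fun is_pos :: "'l label \<Rightarrow> bool" where
  "is_pos (PosL w) = True"
| "is_pos (NegL w) = False"

text \<open>
  Requiring equal signs in the clause for \<open>Eq\<close> makes the second closure rule inapplicable
  without constraining the values of labels that do not occur on the branch.
\<close>

fun holds ::
  "'u sci_struct \<Rightarrow> ('p form \<Rightarrow> 'u) \<Rightarrow> ('l label \<Rightarrow> 'u) \<Rightarrow> ('p, 'l) item \<Rightarrow> bool" where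
  "holds M V I (Lab w \<phi>) \<longleftrightarrow> I w = V \<phi> \<and> (is_pos w \<longleftrightarrow> V \<phi> \<in> desig M)"
| "holds M V I (Eq w v) \<longleftrightarrow> I w = I v \<and> (is_pos w \<longleftrightarrow> is_pos v)"
| "holds M V I (Neq w v) \<longleftrightarrow> I w \<noteq> I v"
| "holds M V I Bot \<longleftrightarrow> False"

lemma holds_cong:
  "(\<And>l. l \<in> item_labels i \<Longrightarrow> I l = J l) \<Longrightarrow> holds M V I i \<longleftrightarrow> holds M V J i"
  by (cases i) auto

lemma approx_value: "\<forall>i\<in>B. holds M V I i \<Longrightarrow> approx B \<phi> \<psi> \<Longrightarrow> V \<phi> = V \<psi>"
  unfolding approx_def by (metis holds.simps(1,2))

text \<open>The signs agree because each of them records whether the common value is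
  designated.\<close>

lemma holds_Lab_Eq:
  "holds M V I (Lab w \<phi>) \<Longrightarrow> holds M V I (Lab v \<psi>) \<Longrightarrow> V \<phi> = V \<psi> \<Longrightarrow> holds M V I (Eq w v)"
  by simp

lemma not_closure_rule: "\<forall>i\<in>B. holds M V I i \<Longrightarrow> \<not> closure_rule B"
  by (metis closure_rule.cases holds.simps(2,3) is_pos.simps)

section \<open>Soundness of the rules in a fixed model\<close>

context
  fixes M :: "'u sci_struct" and V :: "'p form \<Rightarrow> 'u"
  assumes model: "sci_model M" and val: "valuation M V"
begin

lemma V_Neg: "V (Neg \<phi>) \<in> desig M \<longleftrightarrow> V \<phi> \<notin> desig M"
  using model val unfolding sci_model_def valuation_def by metis

lemma V_Imp: "V (Imp \<phi> \<psi>) \<in> desig M \<longleftrightarrow> V \<phi> \<notin> desig M \<or> V \<psi> \<in> desig M"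
  using model val unfolding sci_model_def valuation_def by metis

lemma V_Ident: "V (Ident \<phi> \<psi>) \<in> desig M \<longleftrightarrow> V \<phi> = V \<psi>"
  using model val unfolding sci_model_def valuation_def by metis

text \<open>The value of a compound formula depends only on the values of its components, so
  equality rules equate labels of formulas with equal values; symmetry and transitivity are
  inherited from equality in the model. The interpretation \<open>I\<close> stays unchanged.\<close>

lemma equality_rule_sound:
  assumes B: "\<forall>i\<in>B. holds M V I i" and "equality_rule B e"
  shows "holds M V I e"
  using assms(2)
proof cases
  case (eq_neg \<phi> \<psi> u y)
  then have "V (Neg \<phi>) = V (Neg \<psi>)"
    using approx_value[OF B] val by (simp add: valuation_def)
  with eq_neg B show ?thesis
    by (metis holds_Lab_Eq)
next
  case (eq_imp \<phi> \<psi> \<chi> \<theta> x z)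
  then have "V (Imp \<phi> \<chi>) = V (Imp \<psi> \<theta>)"
    using approx_value[OF B] val by (simp add: valuation_def)
  with eq_imp B show ?thesis
    by (metis holds_Lab_Eq)
next
  case (eq_ident \<phi> \<psi> \<chi> \<theta> x z)
  then have "V (Ident \<phi> \<chi>) = V (Ident \<psi> \<theta>)"
    using approx_value[OF B] val by (simp add: valuation_def)
  with eq_ident B show ?thesis
    by (metis holds_Lab_Eq)
next
  case (eq_fun w \<phi> v)
  with B show ?thesis
    by (metis holds_Lab_Eq)
next
  case (eq_sym w v)
  with B show ?thesis
    by force
next
  case (eq_tran w v u)
  with B show ?thesis
    by (metis holds.simps(2))
qed

text \<open>The alternatives list all sign combinations of the components compatible with the sign
  of \<open>w\<close>; the model selects one. For a false identity, \<open>Neq\<close> occurs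
  exactly when the signs agree, since different signs already separate the values.\<close>

lemma decomp_alternative:
  assumes "decomp (w, \<phi>) alts" "is_pos w \<longleftrightarrow> V \<phi> \<in> desig M"
  shows "\<exists>X\<in>set alts. \<exists>J. \<forall>i\<in>X. holds M V J i"
  using assms(1)
proof cases
  case (neg_pos w \<phi> v)
  then show ?thesis
    using assms(2) by (auto simp: V_Neg intro: exI[of _ "\<lambda>_. V \<phi>"])
next
  case (neg_neg w \<phi> v)
  then show ?thesis
    using assms(2) by (auto simp: V_Neg intro: exI[of _ "\<lambda>_. V \<phi>"])
next
  case (imp_pos v u v' u' w \<phi> \<psi>)
  \<comment> \<open>One interpretation serves all alternatives: \<open>\<phi>\<close> is labelled
    only by \<open>PosL v'\<close> or \<open>NegL v\<close>, and the labels of \<open>\<psi>\<close>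
    differ from these by \<open>v \<noteq> u\<close>, \<open>v' \<noteq> u'\<close> or their
    sign.\<close>
  let ?J = "\<lambda>l. if l \<in> {PosL v', NegL v} then V \<phi> else V \<psi>"
  have "\<exists>X\<in>set alts. \<forall>i\<in>X. holds M V ?J i"
    using imp_pos assms(2) by (auto simp: V_Imp)
  then show ?thesis by blast
next
  case (imp_neg w \<phi> \<psi> v u)
  let ?J = "\<lambda>l. if l = PosL v then V \<phi> else V \<psi>"
  have "\<exists>X\<in>set alts. \<forall>i\<in>X. holds M V ?J i"
    using imp_neg assms(2) by (auto simp: V_Imp)
  then show ?thesis by blast
next
  case (ident_pos v u v' u' w \<phi> \<psi>)
  let ?J = "\<lambda>l. if l \<in> {PosL v', NegL v} then V \<phi> else V \<psi>"
  have "\<exists>X\<in>set alts. \<forall>i\<in>X. holds M V ?J i"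
    using ident_pos assms(2) by (auto simp: V_Ident)
  then show ?thesis by blast
next
  case (ident_neg v u v' u' w \<phi> \<psi>)
  let ?J = "\<lambda>l. if l \<in> {PosL v', NegL v} then V \<phi> else V \<psi>"
  have "\<exists>X\<in>set alts. \<forall>i\<in>X. holds M V ?J i"
    using ident_neg assms(2) by (auto simp: V_Ident)
  then show ?thesis by blast
qed

text \<open>Closure is impossible on a satisfied branch, equality rules preserve \<open>I\<close>,
  and a decomposition requires values only for its fresh labels.\<close>

lemma extends_sound:
  assumes "extends b ns" and b: "\<forall>i\<in>items b. holds M V I i"
  shows "\<exists>n\<in>set ns. \<exists>J. \<forall>i\<in>items (b @ [n]). holds M V J i"
  using assms(1)
proof cases
  case closure
  then show ?thesis
    using not_closure_rule[OF b] by simp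
next
  case (equality e)
  then show ?thesis
    using equality_rule_sound[OF b] b by auto
next
  case (decomposition w \<phi> alts)
  then have "is_pos w \<longleftrightarrow> V \<phi> \<in> desig M"
    using b by force
  then obtain X J where X: "X \<in> set alts" "\<forall>i\<in>X. holds M V J i"
    using decomp_alternative decomposition(6) by blast
  \<comment> \<open>\<open>K\<close> overrides \<open>I\<close> on the labels of \<open>X\<close>
    only. They are fresh, so the items already on the branch keep their truth.\<close>
  define K where "K l = (if l \<in> labels_of X then J l else I l)" for l
  have "holds M V K i" if "i \<in> X" for i
    using that X(2) holds_cong[of i K J M V] by (force simp: K_def labels_of_def)
  moreover have "holds M V K i" if i: "i \<in> items b" for i
  proof -
    have "item_labels i \<inter> labels_of X = {}"
      using decomposition(7) X(1) i by (auto simp: labels_of_def)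
    then show ?thesis
      using b i holds_cong[of i K I M V] by (force simp: K_def)
  qed
  ultimately show ?thesis
    using X(1) decomposition(1) by auto
qed

text \<open>Descend from the root, choosing at each inner node a child that can be satisfied
  together with the branch so far. \<open>I\<close> is generalised in the induction because it
  changes with every decomposition.\<close>

lemma generated_sound:
  assumes "generated p T" "\<forall>i\<in>items (p @ [root T]). holds M V I i"
  shows "\<exists>b\<in>branches T. \<exists>J. \<forall>i\<in>items (p @ b). holds M V J i"
  using assms
proof (induction arbitrary: I rule: generated.induct)
  case (leaf p n)
  then show ?case by auto
next
  case (extend p n ts)
  have "\<exists>m\<in>set (map root ts). \<exists>J. \<forall>i\<in>items ((p @ [n]) @ [m]). holds M V J i"
    using extend.hyps extend.prems by (intro extends_sound[where I = I]) auto
  then obtain t J where t: "t \<in> set ts" "\<forall>i\<in>items ((p @ [n]) @ [root t]). holds M V J i"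
    by auto
  then obtain c K where "c \<in> branches t" "\<forall>i\<in>items ((p @ [n]) @ c). holds M V K i"
    using extend.IH by blast
  with t(1) show ?case
    by (intro bexI[of _ "n # c"]) auto
qed

end

section \<open>From a model to an open, fully expanded tableau\<close>

theorem theorem1:
  fixes \<phi> :: "'p :: {countable, infinite} form"
  assumes "satisfiable TYPE('u) \<phi>"
  shows "tableau_satisfiable TYPE('l :: {countable, infinite}) \<phi>"
proof -
  obtain M :: "'u sci_struct" and V
    where MV: "sci_model M" "valuation M V" "V \<phi> \<in> desig M"
    using assms by (auto simp: satisfiable_def satisfied_def)
  fix w :: 'l
  obtain T :: "('p, 'l) node tree" where T: "root T = ({Lab (PosL w) \<phi>}, None)" "generated [] T"
    "\<forall>b\<in>branches T. fully_expanded_branch b"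
    using fully_expanded_tree_exists[of "[]" "({Lab (PosL w) \<phi>}, None)"] by auto
  \<comment> \<open>The root item mentions only the label \<open>PosL w\<close>, so a constant
    interpretation satisfies it; its sign is right because \<open>V \<phi>\<close> is
    designated.\<close>
  have "\<exists>b\<in>branches T. \<exists>J. \<forall>i\<in>items ([] @ b). holds M V J i"
    using MV T by (intro generated_sound[where I = "\<lambda>_. V \<phi>"]) auto
  \<comment> \<open>\<open>Bot\<close> never holds, so the satisfied branch is not closed.\<close>
  then have "open_tableau T"
    by (force simp: open_tableau_def closed_tableau_def closed_branch_def)
  with T show ?thesis
    unfolding tableau_satisfiable_def tableau_def fully_expanded_def by auto
qed

end
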